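(* Let $V\in\mathbb{R}_{\ge 0}^{n\times n}$, let $X$ be the permutation matrix of a maximum weight perfect matching for $V$, and let $V'=X^TV$. Then the procedure PricesEFPM, applied to $V'$, runs in $O(n^3)$ time.
   Context: Maximum weight perfect matching: an $n\times n$ permutation matrix $X$ maximizing $\mathrm{tr}(X^TV)$ over all $n\times n$ permutation matrices. Running time is counted as the number of elementary operations (additions, subtractions, comparisons and assignments of real numbers), with $V'$ given as input. Procedure PricesEFPM (input $V'=(v'_{ij})$, with $I=\{1,\ldots,n\}$): 1. Construct $\mathcal{U}=(u_{ij})$ with $u_{ij}=v'_{ij}-v'_{jj}$. 2. Set $\mathbf{y}^{(0)}=(0,\ldots,0)$. 3. Set $y_j^{(1)}=\max_{k\in I}u_{jk}$ for all $j\in I$, and $t=1$. 4. While $y_j^{(t)}>y_j^{(t-1)}$ for some $j\in I$: compute $y_j^{(t+1)}=\max_{k\in I}\{y_k^{(t)}+u_{jk}\}$ for all $j\in I$, and increase $t$ by $1$. 5. Return the prices $p_j=v'_{jj}-y_j^{(t)}$, $j\in I$ (with the final value of $t$). *)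

theory Defs
  imports
    Complex_Main
    "HOL-Library.Landau_Symbols"
    "HOL-Library.Monad_Syntax"
    "HOL-Library.While_Combinator"
    "HOL-Combinatorics.Permutations"
    "Jordan_Normal_Form.Matrix"
begin

section \<open>Maximum weight perfect matchings\<close>

definition permutation_matrix :: "nat \<Rightarrow> real mat \<Rightarrow> bool" where
  "permutation_matrix n X \<longleftrightarrow>
     (\<exists>\<pi>. \<pi> permutes {..<n} \<and> X = mat n n (\<lambda>(i, j). if j = \<pi> i then 1 else 0))"

definition trace :: "real mat \<Rightarrow> real" where
  "trace A = (\<Sum>i<dim_row A. A $$ (i, i))"

definition max_weight_perfect_matching :: "nat \<Rightarrow> real mat \<Rightarrow> real mat \<Rightarrow> bool" where
  "max_weight_perfect_matching n V X \<longleftrightarrow>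
     permutation_matrix n X \<and>
     (\<forall>Y. permutation_matrix n Y \<longrightarrow> trace (Y\<^sup>T * V) \<le> trace (X\<^sup>T * V))"


section \<open>Computations with a count of elementary operations\<close>

text \<open>
  A computation either runs forever or returns a value together with the number of elementary
  operations performed. Operations are charged by the primitives below and nowhere else. Control
  flow, enumeration of the index set and read access to stored values are free, as only arithmetic,
  comparisons and assignments are counted.
\<close>

datatype 'a timed = Diverges | Returns (result: 'a) (cost: nat)

definition return :: "'a \<Rightarrow> 'a timed" where
  "return x = Returns x 0"

definition tick :: "'a \<Rightarrow> 'a timed" where
  "tick x = Returns x 1"

fun bind_timed :: "'a timed \<Rightarrow> ('a \<Rightarrow> 'b timed) \<Rightarrow> 'b timed" where
  "bind_timed Diverges f = Diverges"
| "bind_timed (Returns x c) f =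
     (case f x of Diverges \<Rightarrow> Diverges | Returns y d \<Rightarrow> Returns y (c + d))"

adhoc_overloading Monad_Syntax.bind \<rightleftharpoons> bind_timed

definition add :: "'a::plus \<Rightarrow> 'a \<Rightarrow> 'a timed" where
  "add x y = tick (x + y)"

definition sub :: "real \<Rightarrow> real \<Rightarrow> real timed" where
  "sub x y = tick (x - y)"

definition less :: "real \<Rightarrow> real \<Rightarrow> bool timed" where
  "less x y = tick (x < y)"

definition assign :: "'a \<Rightarrow> 'a timed" where
  "assign x = tick x"

definition store :: "('i \<Rightarrow> real) \<Rightarrow> 'i \<Rightarrow> real \<Rightarrow> ('i \<Rightarrow> real) timed" where
  "store a i x = tick (a(i := x))"

fun for_each :: "'i list \<Rightarrow> ('i \<Rightarrow> 's \<Rightarrow> 's timed) \<Rightarrow> 's \<Rightarrow> 's timed" where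
  "for_each [] f s = return s"
| "for_each (i # is) f s = do { s' \<leftarrow> f i s; for_each is f s' }"

fun for_some :: "'i list \<Rightarrow> ('i \<Rightarrow> bool timed) \<Rightarrow> bool timed" where
  "for_some [] P = return False"
| "for_some (i # is) P = do { b \<leftarrow> P i; if b then return True else for_some is P }"

text \<open>
  The loop iterates on the computation performed so far, whose value is the current state paired
  with the outcome of the latest test; \<^const>\<open>bind_timed\<close> thereby adds up the costs. The recursion
  equation of a while loop is derived below.
\<close>

definition while_timed :: "('s \<Rightarrow> bool timed) \<Rightarrow> ('s \<Rightarrow> 's timed) \<Rightarrow> 's \<Rightarrow> 's timed" where
  "while_timed test body s =
     (let check = (\<lambda>s. do { b \<leftarrow> test s; return (s, b) }) in
      case while_option
             (\<lambda>r. case r of Diverges \<Rightarrow> False | Returns (s, b) _ \<Rightarrow> b)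
             (\<lambda>r. do { (s, _) \<leftarrow> r; s' \<leftarrow> body s; check s' })
             (check s)
      of None \<Rightarrow> Diverges
       | Some r \<Rightarrow> do { (s, _) \<leftarrow> r; return s })"


lemma while_timed_unfold:
  "while_timed test body s =
     do { b \<leftarrow> test s; if b then do { s' \<leftarrow> body s; while_timed test body s' } else return s }"
proof -
  define charge :: "nat \<Rightarrow> ('a \<times> bool) timed \<Rightarrow> ('a \<times> bool) timed"
    where "charge c r = (case r of Diverges \<Rightarrow> Diverges | Returns x d \<Rightarrow> Returns x (c + d))" for c r
  define check where "check s = do { b \<leftarrow> test s; return (s, b) }" for s
  define cond where "cond r = (case r of Diverges \<Rightarrow> False | Returns (s :: 'a, b) _ \<Rightarrow> b)" for r
  define step where "step r = do { (s, _) \<leftarrow> r; s' \<leftarrow> body s; check s' }" for r :: "('a \<times> bool) timed"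
  define loop where "loop r = (case while_option cond step r of None \<Rightarrow> Diverges
    | Some r \<Rightarrow> do { (s, _) \<leftarrow> r; return s })" for r
  have while_eq: "while_timed test body s = loop (check s)" for s
    unfolding while_timed_def loop_def cond_def [abs_def] step_def [abs_def] check_def [abs_def] Let_def ..
  have loop_Diverges: "loop Diverges = Diverges"
    unfolding loop_def by (subst while_option_unfold) (simp add: cond_def)
  have loop_stop: "loop (Returns (s, False) c) = Returns s c" for s c
    unfolding loop_def by (subst while_option_unfold) (simp add: cond_def return_def)
  have loop_step: "loop (Returns (s, True) c) = loop (step (Returns (s, True) c))" for s c
    unfolding loop_def by (subst while_option_unfold) (simp add: cond_def)
  have "map_option (charge c) (while_option cond step r) = while_option cond step (charge c r)" for c r
    by (rule while_option_commute)
      (auto simp: cond_def step_def charge_def split: timed.splits prod.splits)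
  then have commute: "while_option cond step (charge c r) = map_option (charge c) (while_option cond step r)" for c r
    by simp
  have loop_charge: "loop (charge c r) =
      (case loop r of Diverges \<Rightarrow> Diverges | Returns x d \<Rightarrow> Returns x (c + d))" for c r
    unfolding loop_def commute
    by (auto simp: charge_def return_def split: option.splits timed.splits prod.splits)
  show ?thesis
  proof (cases "test s")
    case Diverges
    then show ?thesis by (simp add: while_eq check_def loop_Diverges)
  next
    case (Returns b c)
    then have check: "check s = Returns (s, b) c"
      by (simp add: check_def return_def)
    show ?thesis
    proof (cases b)
      case False
      then show ?thesis using Returns check by (simp add: while_eq loop_stop return_def)
    next
      case True
      show ?thesis
      proof (cases "body s")
        case Diverges
        then show ?thesis
          using Returns check True by (simp add: while_eq loop_step step_def loop_Diverges)
      next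
        case (Returns s' d)
        have "step (Returns (s, True) c) = charge (c + d) (check s')"
          using Returns by (auto simp: step_def charge_def split: timed.splits)
        then show ?thesis
          using \<open>test s = _\<close> Returns check True
          by (auto simp: while_eq loop_step loop_charge split: timed.splits)
      qed
    qed
  qed
qed


section \<open>The procedure\<close>

definition max_over :: "nat \<Rightarrow> (nat \<Rightarrow> real timed) \<Rightarrow> real timed" where
  "max_over n f = do {
     x \<leftarrow> f 0;
     m \<leftarrow> assign x;
     for_each [1..<n] (\<lambda>k m. do {
       x \<leftarrow> f k;
       x \<leftarrow> assign x;
       b \<leftarrow> less m x;
       if b then assign x else return m }) m }"

text \<open>
  The index set is \<open>{0..<n}\<close> rather than \<open>{1..n}\<close>, and \<open>y (t, j)\<close> stands for \<open>y\<^sub>j\<close> at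
  superscript \<open>t\<close>. Arrays are uninitialised (\<open>undefined\<close>) until written. Operations on the
  integer \<open>t\<close> are charged like operations on reals.
\<close>

definition PricesEFPM :: "real mat \<Rightarrow> real vec timed" where
  "PricesEFPM V' = (let n = dim_row V' in do {
     u \<leftarrow> for_each [0..<n] (\<lambda>i. for_each [0..<n] (\<lambda>j u. do {
            d \<leftarrow> sub (V' $$ (i, j)) (V' $$ (j, j));
            store u (i, j) d })) undefined;
     y \<leftarrow> for_each [0..<n] (\<lambda>j y. store y (0, j) 0) undefined;
     y \<leftarrow> for_each [0..<n] (\<lambda>j y. do {
            m \<leftarrow> max_over n (\<lambda>k. return (u (j, k)));
            store y (1, j) m }) y;
     t \<leftarrow> assign (1 :: nat);
     (t, y) \<leftarrow> while_timed
       (\<lambda>(t, y). for_some [0..<n] (\<lambda>j. less (y (t - 1, j)) (y (t, j))))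
       (\<lambda>(t, y). do {
          y \<leftarrow> for_each [0..<n] (\<lambda>j y. do {
                 m \<leftarrow> max_over n (\<lambda>k. add (y (t, k)) (u (j, k)));
                 store y (t + 1, j) m }) y;
          t' \<leftarrow> add t 1;
          t \<leftarrow> assign t';
          return (t, y) })
       (t, y);
     p \<leftarrow> for_each [0..<n] (\<lambda>j p. do {
            d \<leftarrow> sub (V' $$ (j, j)) (y (t, j));
            store p j d }) undefined;
     return (vec n p) })"

end

theory Submission
  imports Defs
begin

text \<open>
  Since \<open>V' = X\<^sup>T V\<close> has the identity as a maximum weight matching, every cycle has nonpositive
  weight with respect to \<open>\<U>\<close>. The number \<open>y\<^sub>j\<close> at superscript \<open>t\<close> is the maximal weight of a walk
  with \<open>t\<close> edges starting in \<open>j\<close>, and it is nondecreasing in \<open>t\<close> because loops have weight zero. A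
  walk with \<open>n\<close> edges contains a cycle, whose removal does not decrease the weight, so the values
  at \<open>n\<close> and \<open>n - 1\<close> agree. The loop is thus left with \<open>t \<le> n\<close>, and each iteration takes
  \<open>O(n\<^sup>2)\<close> operations.
\<close>

section \<open>Bounding the cost of computations\<close>

text \<open>A total-correctness triple with a cost budget: termination, cost and computed values are
  tracked together, because the values decide when the loop stops.\<close>

definition returns_within :: "'a timed \<Rightarrow> nat \<Rightarrow> ('a \<Rightarrow> bool) \<Rightarrow> bool" where
  "returns_within m c Q \<longleftrightarrow> (\<exists>x d. m = Returns x d \<and> d \<le> c \<and> Q x)"

lemma returns_within_mono:
  assumes "returns_within m c Q" "c \<le> d" "\<And>x. Q x \<Longrightarrow> R x"
  shows "returns_within m d R"
  using assms by (fastforce simp: returns_within_def)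

lemma returns_within_return: "Q x \<Longrightarrow> returns_within (return x) 0 Q"
  by (simp add: returns_within_def return_def)

lemma returns_within_tick: "Q x \<Longrightarrow> returns_within (tick x) 1 Q"
  by (simp add: returns_within_def tick_def)

lemma returns_within_tick_eq: "returns_within (tick x) 1 (\<lambda>y. y = x)"
  by (rule returns_within_tick) simp

lemma returns_within_bind:
  assumes "returns_within m c Q" "\<And>x. Q x \<Longrightarrow> returns_within (f x) d R"
  shows "returns_within (bind_timed m f) (c + d) R"
proof -
  from assms(1) obtain x c' where x: "m = Returns x c'" "c' \<le> c" "Q x"
    by (auto simp: returns_within_def)
  from assms(2)[OF x(3)] obtain y d' where "f x = Returns y d'" "d' \<le> d" "R y"
    by (auto simp: returns_within_def)
  with x show ?thesis by (simp add: returns_within_def)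
qed

lemma returns_within_for_each_upt:
  assumes "a \<le> b" "Inv a s"
    and "\<And>i s. a \<le> i \<Longrightarrow> i < b \<Longrightarrow> Inv i s \<Longrightarrow> returns_within (f i s) c (Inv (Suc i))"
  shows "returns_within (for_each [a..<b] f s) ((b - a) * c) (Inv b)"
  using assms
proof (induction "b - a" arbitrary: a s)
  case 0
  then show ?case by (auto intro: returns_within_return)
next
  case (Suc k)
  then have *: "[a..<b] = a # [Suc a..<b]" "(b - a) * c = c + (b - Suc a) * c"
    using mult_Suc[of "b - Suc a" c] by (auto simp: upt_conv_Cons Suc_diff_Suc)
  show ?case
    unfolding * for_each.simps
  proof (rule returns_within_bind)
    show "returns_within (f a s) c (Inv (Suc a))"
      using Suc by auto
  next
    fix s' assume "Inv (Suc a) s'"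
    then show "returns_within (for_each [Suc a..<b] f s') ((b - Suc a) * c) (Inv b)"
      using Suc by (intro Suc.hyps(1)) auto
  qed
qed

text \<open>The budget pays for a full scan; leaving at the first success only saves
  operations.\<close>

lemma returns_within_for_some:
  assumes "\<And>i. i \<in> set xs \<Longrightarrow> returns_within (P i) c (\<lambda>b. b \<longleftrightarrow> p i)"
  shows "returns_within (for_some xs P) (length xs * c) (\<lambda>b. b \<longleftrightarrow> (\<exists>i\<in>set xs. p i))"
  using assms
proof (induction xs)
  case Nil
  then show ?case by (auto intro: returns_within_return)
next
  case (Cons i xs)
  show ?case
    unfolding for_some.simps length_Cons mult_Suc
  proof (rule returns_within_bind)
    show "returns_within (P i) c (\<lambda>b. b \<longleftrightarrow> p i)"
      using Cons by simp
  next
    fix b assume "b \<longleftrightarrow> p i"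
    then show "returns_within (if b then return True else for_some xs P) (length xs * c)
        (\<lambda>b. b \<longleftrightarrow> (\<exists>i\<in>set (i # xs). p i))"
      using Cons by (auto intro: returns_within_mono[OF returns_within_return[where Q = "\<lambda>b. b"]])
  qed
qed

text \<open>The variant \<open>\<mu>\<close> also bounds the number of iterations, since each one
  lowers it by at least 1. Every iteration pays for one test and one body; the separate
  \<open>c\<close> pays for the final failing test.\<close>

lemma returns_within_while:
  assumes "Inv s"
    and test: "\<And>s. Inv s \<Longrightarrow> returns_within (test s) c (\<lambda>b. b \<longleftrightarrow> B s)"
    and body: "\<And>s. Inv s \<Longrightarrow> B s \<Longrightarrow> returns_within (body s) d (\<lambda>s'. Inv s' \<and> \<mu> s' < \<mu> s)"
  shows "returns_within (while_timed test body s) (c + \<mu> s * (c + d)) Inv"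
  using assms(1)
proof (induction "\<mu> s" arbitrary: s rule: less_induct)
  case less
  show ?case
    unfolding while_timed_unfold[of test body s]
  proof (rule returns_within_bind[OF test[OF less.prems]])
    fix b assume b: "b \<longleftrightarrow> B s"
    show "returns_within (if b then bind_timed (body s) (while_timed test body) else return s)
        (\<mu> s * (c + d)) Inv"
    proof (cases b)
      case True
      have "returns_within (bind_timed (body s) (while_timed test body))
          (d + (c + (\<mu> s - 1) * (c + d))) Inv"
      proof (rule returns_within_bind[OF body])
        fix s' assume s': "Inv s' \<and> \<mu> s' < \<mu> s"
        then have "\<mu> s' * (c + d) \<le> (\<mu> s - 1) * (c + d)"
          by (intro mult_right_mono) auto
        then show "returns_within (while_timed test body s') (c + (\<mu> s - 1) * (c + d)) Inv"
          using s' by (intro returns_within_mono[OF less.hyps[of s']] add_left_mono) auto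
      qed (use less True b in auto)
      \<comment> \<open>The body strictly lowers \<open>\<mu>\<close>, so \<open>\<mu> s\<close> is
        positive and the truncated subtraction \<open>\<mu> s - 1\<close> is exact.\<close>
      moreover have "0 < \<mu> s"
        using body[OF less.prems] True b by (auto simp: returns_within_def)
      then have "d + (c + (\<mu> s - 1) * (c + d)) = \<mu> s * (c + d)"
        by (cases "\<mu> s") auto
      ultimately show ?thesis using True by simp
    next
      case False
      then show ?thesis
        using less by (auto intro!: returns_within_mono[OF returns_within_return[where Q = Inv]])
    qed
  qed
qed

text \<open>Beyond evaluating a candidate, each pass pays for storing it, comparing it and possibly
  replacing the maximum, hence \<open>c + 3\<close>; the candidate at 0 needs only
  \<open>c + 1\<close>.\<close>

lemma returns_within_max_over:
  assumes "1 \<le> n" and f: "\<And>k. k < n \<Longrightarrow> returns_within (f k) c (\<lambda>x. x = g k)"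
  shows "returns_within (max_over n f) (n * (c + 3)) (\<lambda>x. x = Max (g ` {..<n}))"
proof -
  have step: "returns_within (do {
       x \<leftarrow> f k; x \<leftarrow> assign x; b \<leftarrow> less m x; if b then assign x else return m })
      (c + (1 + (1 + 1))) (\<lambda>m. m = Max (g ` {..<Suc k}))"
    if k: "1 \<le> k" "k < n" "m = Max (g ` {..<k})" for k m
    unfolding assign_def less_def
  proof (rule returns_within_bind[OF f[OF k(2)]], rule returns_within_bind[OF returns_within_tick_eq],
      rule returns_within_bind[OF returns_within_tick_eq])
    fix x y b assume "x = g k" "y = x" "b = (m < y)"
    moreover have "Max (g ` {..<Suc k}) = max (g k) (Max (g ` {..<k}))"
      using k by (auto simp: lessThan_Suc lessThan_empty_iff intro!: Max_insert)
    ultimately show "returns_within (if b then tick y else return m) 1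
        (\<lambda>m. m = Max (g ` {..<Suc k}))"
      using k by (auto simp: returns_within_def tick_def return_def)
  qed
  have "returns_within (max_over n f) (c + (1 + (n - 1) * (c + (1 + (1 + 1)))))
      (\<lambda>x. x = Max (g ` {..<n}))"
    unfolding max_over_def
  proof (rule returns_within_bind[OF f])
    fix x assume x: "x = g 0"
    have "returns_within (assign x) 1 (\<lambda>m. m = Max (g ` {..<1}))"
      unfolding assign_def by (rule returns_within_tick) (simp add: x lessThan_Suc)
    then show "returns_within (bind_timed (assign x) (for_each [1..<n] (\<lambda>k m. do {
        x \<leftarrow> f k; x \<leftarrow> assign x; b \<leftarrow> less m x; if b then assign x else return m })))
        (1 + (n - 1) * (c + (1 + (1 + 1)))) (\<lambda>x. x = Max (g ` {..<n}))"
      by (rule returns_within_bind,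
          intro returns_within_for_each_upt[where Inv = "\<lambda>k m. m = Max (g ` {..<k})"] step)
        (use \<open>1 \<le> n\<close> in auto)
  qed (use \<open>1 \<le> n\<close> in auto)
  moreover have "c + (1 + (n - 1) * (c + (1 + (1 + 1)))) \<le> n * (c + 3)"
    using \<open>1 \<le> n\<close> by (cases n) (auto simp: algebra_simps)
  ultimately show ?thesis by (rule returns_within_mono) auto
qed

section \<open>Walks of maximal weight\<close>

text \<open>The recursion removes the first edge of a walk, as the update of the procedure does.
  Starting from 0, its value at \<open>Suc 0\<close> is the row maximum that the procedure computes
  before the loop.\<close>

fun walk_max :: "nat \<Rightarrow> (nat \<Rightarrow> nat \<Rightarrow> real) \<Rightarrow> nat \<Rightarrow> nat \<Rightarrow> real" where
  "walk_max n u 0 j = 0"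
| "walk_max n u (Suc t) j = Max ((\<lambda>k. walk_max n u t k + u j k) ` {..<n})"

text \<open>Induction on the length: split off the first edge and bound the shifted walk.\<close>

lemma walk_max_upper:
  assumes "\<And>i. i \<le> t \<Longrightarrow> w i < n"
  shows "(\<Sum>i<t. u (w i) (w (Suc i))) \<le> walk_max n u t (w 0)"
  using assms
proof (induction t arbitrary: w)
  case (Suc t)
  have "(\<Sum>i<Suc t. u (w i) (w (Suc i))) =
      u (w 0) (w 1) + (\<Sum>i<t. u (w (Suc i)) (w (Suc (Suc i))))"
    by (subst sum.lessThan_Suc_shift) simp
  also have "\<dots> \<le> u (w 0) (w 1) + walk_max n u t (w 1)"
    using Suc.IH[of "\<lambda>i. w (Suc i)"] Suc.prems by simp
  also have "\<dots> \<le> walk_max n u (Suc t) (w 0)"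
    using Suc.prems[of 1] by (auto intro!: Max_ge simp: add.commute)
  finally show ?case .
qed simp

text \<open>An optimal walk arises by putting \<open>j\<close> in front of an optimal walk from a
  maximizing successor \<open>k\<close>; \<open>case_nat j w\<close> is this longer walk.\<close>

lemma walk_max_attained:
  assumes "j < n"
  obtains w where "w 0 = j" "\<And>i. i \<le> t \<Longrightarrow> w i < n"
    "walk_max n u t j = (\<Sum>i<t. u (w i) (w (Suc i)))"
  using assms
proof (induction t arbitrary: j thesis)
  case 0
  show ?case by (rule 0(1)[of "\<lambda>_. j"]) (use 0 in auto)
next
  case (Suc t)
  have "walk_max n u (Suc t) j \<in> (\<lambda>k. walk_max n u t k + u j k) ` {..<n}"
    unfolding walk_max.simps using Suc.prems by (intro Max_in) auto
  then obtain k where k: "k < n" "walk_max n u (Suc t) j = walk_max n u t k + u j k"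
    by auto
  obtain w where w: "w 0 = k" "\<And>i. i \<le> t \<Longrightarrow> w i < n"
    "walk_max n u t k = (\<Sum>i<t. u (w i) (w (Suc i)))"
    using Suc.IH[OF _ k(1)] by blast
  show ?case
  proof (rule Suc.prems(1)[of "case_nat j w"])
    show "walk_max n u (Suc t) j = (\<Sum>i<Suc t. u (case_nat j w i) (case_nat j w (Suc i)))"
      using k w by (subst sum.lessThan_Suc_shift) simp
  qed (use w Suc.prems in \<open>auto split: nat.splits\<close>)
qed

text \<open>Any walk from \<open>j\<close> can be prolonged by a loop of weight zero at
  \<open>j\<close>.\<close>

lemma walk_max_mono:
  assumes diag: "\<And>i. i < n \<Longrightarrow> u i i = 0" and "s \<le> t" "j < n"
  shows "walk_max n u s j \<le> walk_max n u t j"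
  using \<open>s \<le> t\<close>
proof (induction rule: dec_induct)
  case (step t)
  have "walk_max n u t j + u j j \<le> walk_max n u (Suc t) j"
    using \<open>j < n\<close> by (auto intro!: Max_ge)
  with step diag[OF \<open>j < n\<close>] show ?case by simp
qed simp

text \<open>A simple cycle becomes a permutation of all vertices by fixing the vertices off the
  cycle. Fixed points contribute \<open>u i i = 0\<close>, so the permutation weighs exactly as much
  as the cycle.\<close>

lemma simple_cycle_weight_nonpos:
  fixes u :: "nat \<Rightarrow> nat \<Rightarrow> real"
  assumes diag: "\<And>i. i < n \<Longrightarrow> u i i = 0"
    and perm: "\<And>\<sigma>. \<sigma> permutes {..<n} \<Longrightarrow> (\<Sum>i<n. u i (\<sigma> i)) \<le> 0"
    and w: "\<And>i. i < l \<Longrightarrow> w i < n" and inj: "inj_on w {..<l}" and closed: "w l = w 0"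
  shows "(\<Sum>i<l. u (w i) (w (Suc i))) \<le> 0"
proof (cases "l = 0")
  case False
  define C where "C = w ` {..<l}"
  \<comment> \<open>The successor map on the cycle: injectivity makes the position of a vertex
    unique.\<close>
  define \<sigma> where "\<sigma> x = (if x \<in> C then w (Suc (inv_into {..<l} w x)) else x)" for x
  have \<sigma>w: "\<sigma> (w i) = w (Suc i)" if "i < l" for i
    using that inj by (simp add: \<sigma>_def C_def)
  have "w (Suc i) \<in> C" if "i < l" for i
    using that closed False unfolding C_def
    by (cases "Suc i = l") auto
  \<comment> \<open>Every vertex of the cycle is a successor; position 0 is reached from
    \<open>l - 1\<close> because the walk is closed. A surjective self-map of the finite set
    \<open>C\<close> is then a bijection.\<close>
  moreover have "w i \<in> (\<lambda>i. w (Suc i)) ` {..<l}" if "i < l" for i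
    using that closed False by (cases i) (auto intro!: image_eqI[of _ _ "l - 1"])
  ultimately have "\<sigma> ` C = C"
    by (auto simp: C_def image_image \<sigma>w)
  moreover have "finite C" by (simp add: C_def)
  ultimately have "bij_betw \<sigma> C C"
    by (simp add: bij_betw_def eq_card_imp_inj_on)
  then have "\<sigma> permutes C"
    by (rule bij_imp_permutes) (simp add: \<sigma>_def)
  moreover have "C \<subseteq> {..<n}"
    using w by (auto simp: C_def)
  ultimately have "\<sigma> permutes {..<n}"
    by (rule permutes_subset)
  then have "(\<Sum>x<n. u x (\<sigma> x)) \<le> 0" by (rule perm)
  moreover have "(\<Sum>x<n. u x (\<sigma> x)) = (\<Sum>x\<in>C. u x (\<sigma> x))"
    using \<open>C \<subseteq> {..<n}\<close> diag by (intro sum.mono_neutral_right) (auto simp: \<sigma>_def)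
  moreover have "\<dots> = (\<Sum>i<l. u (w i) (w (Suc i)))"
    unfolding C_def using inj by (simp add: sum.reindex \<sigma>w)
  ultimately show ?thesis by simp
qed simp

lemma walk_max_stationary:
  fixes u :: "nat \<Rightarrow> nat \<Rightarrow> real"
  assumes diag: "\<And>i. i < n \<Longrightarrow> u i i = 0"
    and perm: "\<And>\<sigma>. \<sigma> permutes {..<n} \<Longrightarrow> (\<Sum>i<n. u i (\<sigma> i)) \<le> 0"
    and "j < n"
  shows "walk_max n u n j \<le> walk_max n u (n - 1) j"
proof -
  obtain w where w: "w 0 = j" "\<And>i. i \<le> n \<Longrightarrow> w i < n"
    "walk_max n u n j = (\<Sum>i<n. u (w i) (w (Suc i)))"
    using walk_max_attained[OF \<open>j < n\<close>, of n u] by blast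
  \<comment> \<open>\<open>rep l\<close> means that the walk has a closed segment of
    \<open>l\<close> edges. The least such \<open>l\<close> will give a simple cycle.\<close>
  define rep where "rep l \<longleftrightarrow> 0 < l \<and> (\<exists>a. a + l \<le> n \<and> w (a + l) = w a)" for l
  \<comment> \<open>Pigeonhole: \<open>n + 1\<close> positions share \<open>n\<close>
    vertices.\<close>
  have "\<not> inj_on w {..n}"
    using w(2) card_inj_on_le[of w "{..n}" "{..<n}"] by fastforce
  then obtain a b where "a < b" "b \<le> n" "w a = w b"
    unfolding inj_on_def by (metis atMost_iff linorder_neqE_nat)
  then have "rep (b - a)" by (auto simp: rep_def intro!: exI[of _ a])
  define l where "l = (LEAST l. rep l)"
  have "rep l" using \<open>rep (b - a)\<close> unfolding l_def by (rule LeastI)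
  then obtain a where a: "0 < l" "a + l \<le> n" "w (a + l) = w a"
    by (auto simp: rep_def)
  \<comment> \<open>A repetition inside the segment would be a shorter closed segment, against the
    minimality of \<open>l\<close>.\<close>
  have "inj_on (\<lambda>i. w (a + i)) {..<l}"
  proof (rule linorder_inj_onI)
    fix i k assume "i < k" "i \<in> {..<l}" "k \<in> {..<l}"
    then have "k - i < l" by auto
    then have "\<not> rep (k - i)" unfolding l_def by (rule not_less_Least)
    then show "w (a + i) \<noteq> w (a + k)"
      using \<open>i < k\<close> \<open>k \<in> {..<l}\<close> a by (auto simp: rep_def dest!: spec[of _ "a + i"])
  qed auto
  then have cycle: "(\<Sum>i<l. u (w (a + i)) (w (a + Suc i))) \<le> 0"
    using a w(2) simple_cycle_weight_nonpos[of n u l "\<lambda>i. w (a + i)"] diag perm by auto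
  \<comment> \<open>The walk with the closed segment cut out; the two pieces fit together at
    \<open>a\<close> because \<open>w (a + l) = w a\<close>.\<close>
  define w' where "w' i = (if i \<le> a then w i else w (i + l))" for i
  define m where "m = n - l - a"
  have n: "n = a + (l + m)" using a by (simp add: m_def)
  have split: "(\<Sum>i<p + q. f i) = (\<Sum>i<p. f i) + (\<Sum>i<q. f (p + i))" for p q and f :: "nat \<Rightarrow> real"
    by (induction q) (auto simp: add.assoc)
  have "walk_max n u n j = (\<Sum>i<a. u (w i) (w (Suc i))) +
      ((\<Sum>i<l. u (w (a + i)) (w (a + Suc i))) +
       (\<Sum>i<m. u (w (a + (l + i))) (w (Suc (a + (l + i))))))"
    unfolding w(3) by (subst n) (simp add: split)
  also have "\<dots> \<le> (\<Sum>i<a. u (w i) (w (Suc i))) +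
       (\<Sum>i<m. u (w (a + (l + i))) (w (Suc (a + (l + i)))))"
    using cycle by simp
  also have "\<dots> = (\<Sum>i<a + m. u (w' i) (w' (Suc i)))"
    unfolding split using a(3)
    by (intro arg_cong2[where f = "(+)"] sum.cong) (auto simp: w'_def ac_simps)
  also have "\<dots> \<le> walk_max n u (a + m) (w' 0)"
    using w(2) n by (intro walk_max_upper) (auto simp: w'_def)
  \<comment> \<open>At least one edge was cut, so \<open>a + m \<le> n - 1\<close>, and monotonicity
    closes the gap.\<close>
  also have "\<dots> \<le> walk_max n u (n - 1) (w' 0)"
    using a n w \<open>j < n\<close> by (intro walk_max_mono diag) (auto simp: w'_def)
  finally show ?thesis using w(1) by (simp add: w'_def)
qed

section \<open>Maximum weight matchings moved to the diagonal\<close>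

text \<open>In the scalar product only the index \<open>k\<close> with \<open>\<pi> k = i\<close>
  survives.\<close>

lemma permutation_matrix_transpose_mult_index:
  assumes "\<pi> permutes {..<n}" "V \<in> carrier_mat n n" "i < n" "j < n"
  shows "((mat n n (\<lambda>(i, j). if j = \<pi> i then 1 else 0))\<^sup>T * V) $$ (i, j) =
    (V $$ (inv_into UNIV \<pi> i, j) :: real)"
proof -
  have "inv_into UNIV \<pi> i \<in> {..<n}"
    using assms permutes_in_image[OF permutes_inv[OF assms(1)], of i] by simp
  moreover have "i = \<pi> k \<longleftrightarrow> k = inv_into UNIV \<pi> i" for k
    using permutes_inverses[OF assms(1)] by metis
  ultimately show ?thesis
    using assms by (simp add: scalar_prod_def if_distrib[of "\<lambda>x. x * _"] sum.delta cong: if_cong)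
qed

lemma trace_permutation_matrix_transpose_mult:
  assumes "\<pi> permutes {..<n}" "V \<in> carrier_mat n n"
  shows "trace ((mat n n (\<lambda>(i, j). if j = \<pi> i then 1 else 0))\<^sup>T * V) = (\<Sum>i<n. V $$ (i, \<pi> i))"
proof -
  have "trace ((mat n n (\<lambda>(i, j). if j = \<pi> i then 1 else 0))\<^sup>T * V) = (\<Sum>i<n. V $$ (inv_into UNIV \<pi> i, i))"
    unfolding trace_def using permutation_matrix_transpose_mult_index[OF assms]
    by (intro sum.cong) auto
  also have "\<dots> = (\<Sum>i<n. V $$ (i, \<pi> i))"
    using sum.permute[OF assms(1), of "\<lambda>i. V $$ (inv_into UNIV \<pi> i, i)"] permutes_inverses[OF assms(1)]
    by (simp add: comp_def)
  finally show ?thesis .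
qed

text \<open>Reindexing the rows by \<open>\<pi>\<close> shows that \<open>\<sigma>\<close> weighs in
  \<open>X\<^sup>T * V\<close> what \<open>\<sigma> \<circ> \<pi>\<close> weighs in
  \<open>V\<close>; optimality of \<open>X\<close> bounds this by the trace.\<close>

lemma max_weight_perfect_matching_diagonal:
  assumes V: "V \<in> carrier_mat n n" and X: "max_weight_perfect_matching n V X"
    and \<sigma>: "\<sigma> permutes {..<n}"
  shows "(\<Sum>i<n. (X\<^sup>T * V) $$ (i, \<sigma> i)) \<le> (\<Sum>i<n. (X\<^sup>T * V) $$ (i, i))"
proof -
  obtain \<pi> where \<pi>: "\<pi> permutes {..<n}" and
    X_eq: "X = mat n n (\<lambda>(i, j). if j = \<pi> i then 1 else 0)"
    using X by (auto simp: max_weight_perfect_matching_def permutation_matrix_def)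
  have \<sigma>\<pi>: "\<sigma> \<circ> \<pi> permutes {..<n}"
    by (rule permutes_compose[OF \<pi> \<sigma>])
  have "\<sigma> i < n" if "i < n" for i
    using permutes_in_image[OF \<sigma>, of i] that by simp
  then have "(\<Sum>i<n. (X\<^sup>T * V) $$ (i, \<sigma> i)) = (\<Sum>i<n. V $$ (inv_into UNIV \<pi> i, \<sigma> i))"
    unfolding X_eq using permutation_matrix_transpose_mult_index[OF \<pi> V]
    by (intro sum.cong) auto
  also have "\<dots> = (\<Sum>i<n. V $$ (i, (\<sigma> \<circ> \<pi>) i))"
    using sum.permute[OF \<pi>, of "\<lambda>i. V $$ (inv_into UNIV \<pi> i, \<sigma> i)"] permutes_inverses[OF \<pi>]
    by (simp add: comp_def)
  also have "\<dots> \<le> trace (X\<^sup>T * V)"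
    using X \<sigma>\<pi> unfolding max_weight_perfect_matching_def permutation_matrix_def
      trace_permutation_matrix_transpose_mult[OF \<sigma>\<pi> V, symmetric] by blast
  also have "\<dots> = (\<Sum>i<n. (X\<^sup>T * V) $$ (i, i))"
    by (simp add: trace_def X_eq)
  finally show ?thesis .
qed

section \<open>The running time\<close>

lemma PricesEFPM_returns_within:
  fixes V' :: "real mat"
  defines "n \<equiv> dim_row V'"
  assumes n: "1 \<le> n"
    and opt: "\<And>\<sigma>. \<sigma> permutes {..<n} \<Longrightarrow> (\<Sum>i<n. V' $$ (i, \<sigma> i)) \<le> (\<Sum>i<n. V' $$ (i, i))"
  shows "returns_within (PricesEFPM V') (19 * n ^ 3) (\<lambda>_. True)"
proof -
  define u where "u i j = V' $$ (i, j) - V' $$ (j, j)" for i j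
  define y where "y = walk_max n u"
  \<comment> \<open>A permutation meets every column once, so the subtracted diagonal entries sum to
    the trace, and what remains is the weight of \<open>\<sigma>\<close> minus that of the
    identity.\<close>
  have "(\<Sum>i<n. u i (\<sigma> i)) \<le> 0" if "\<sigma> permutes {..<n}" for \<sigma>
    using opt[OF that] sum.permute[OF that, of "\<lambda>i. V' $$ (i, i)"]
    by (simp add: u_def sum_subtractf comp_def)
  then have stationary: "y n j \<le> y (n - 1) j" if "j < n" for j
    unfolding y_def using that by (intro walk_max_stationary) (auto simp: u_def)

  define row where "row t j Y \<longleftrightarrow> (\<forall>k<j. Y (t, k) = y t k)" for t j and Y :: "nat \<times> nat \<Rightarrow> real"
  define U_ok where "U_ok U \<longleftrightarrow> (\<forall>i<n. \<forall>j<n. U (i, j) = u i j)" for U :: "nat \<times> nat \<Rightarrow> real"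
  \<comment> \<open>Only the rows at \<open>t - 1\<close> and \<open>t\<close> are recorded: the
    test reads both, and the update reads the latter.\<close>
  define Inv where "Inv = (\<lambda>(t, Y). 1 \<le> t \<and> t \<le> n \<and> row (t - 1) n Y \<and> row t n Y)"
  define B where "B = (\<lambda>(t, Y :: nat \<times> nat \<Rightarrow> real). \<exists>j\<in>set [0..<n]. Y (t - 1, j) < Y (t, j))"

  define init_u where "init_u = for_each [0..<n] (\<lambda>i. for_each [0..<n] (\<lambda>j U.
    bind_timed (sub (V' $$ (i, j)) (V' $$ (j, j))) (\<lambda>d. store U (i, j) d))) undefined"
  have init_u: "returns_within init_u ((n - 0) * ((n - 0) * (1 + 1))) U_ok"
  proof -
    have "returns_within init_u ((n - 0) * ((n - 0) * (1 + 1)))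
        (\<lambda>U. \<forall>i'<n. \<forall>j<n. U (i', j) = u i' j)"
      unfolding init_u_def sub_def store_def
    proof (rule returns_within_for_each_upt[where Inv =
          "\<lambda>i U. \<forall>i'<i. \<forall>j<n. U (i', j) = u i' j"])
      fix i and U :: "nat \<times> nat \<Rightarrow> real"
      assume U: "\<forall>i'<i. \<forall>j<n. U (i', j) = u i' j"
      have "returns_within (for_each [0..<n] (\<lambda>j U. bind_timed
            (tick (V' $$ (i, j) - V' $$ (j, j))) (\<lambda>d. tick (U((i, j) := d)))) U)
          ((n - 0) * (1 + 1)) (\<lambda>U. (\<forall>i'<i. \<forall>j<n. U (i', j) = u i' j) \<and> (\<forall>j<n. U (i, j) = u i j))"
      proof (rule returns_within_for_each_upt[where Inv =
            "\<lambda>j U. (\<forall>i'<i. \<forall>j<n. U (i', j) = u i' j) \<and> (\<forall>k<j. U (i, k) = u i k)"])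
        fix j and U :: "nat \<times> nat \<Rightarrow> real"
        assume "(\<forall>i'<i. \<forall>j<n. U (i', j) = u i' j) \<and> (\<forall>k<j. U (i, k) = u i k)"
        then show "returns_within (bind_timed (tick (V' $$ (i, j) - V' $$ (j, j)))
            (\<lambda>d. tick (U((i, j) := d)))) (1 + 1)
            (\<lambda>U. (\<forall>i'<i. \<forall>j<n. U (i', j) = u i' j) \<and> (\<forall>k<Suc j. U (i, k) = u i k))"
          by (intro returns_within_bind[OF returns_within_tick[where Q = "\<lambda>d. d = u i j"]]
              returns_within_tick) (auto simp: u_def less_Suc_eq)
      qed (use U in auto)
      then show "returns_within (for_each [0..<n] (\<lambda>j U. bind_timed
            (tick (V' $$ (i, j) - V' $$ (j, j))) (\<lambda>d. tick (U((i, j) := d)))) U)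
          ((n - 0) * (1 + 1)) (\<lambda>U. \<forall>i'<Suc i. \<forall>j<n. U (i', j) = u i' j)"
        by (rule returns_within_mono) (auto simp: less_Suc_eq)
    qed auto
    then show ?thesis by (simp add: U_ok_def[abs_def])
  qed

  have init_y: "returns_within (for_each [0..<n] (\<lambda>j Y. store Y (0, j) 0) undefined)
      ((n - 0) * 1) (row 0 n)"
    unfolding store_def
    by (intro returns_within_for_each_upt[where Inv = "row 0"] returns_within_tick)
      (auto simp: row_def y_def less_Suc_eq)

  \<comment> \<open>The candidate computation \<open>F\<close> is left abstract so that one argument
    serves both the first row of maxima (\<open>c = 0\<close>, plain reads) and the loop body
    (\<open>c = 1\<close>, one addition each). It takes the current array, which changes while the
    new row is written.\<close>
  have update: "returns_within (for_each [0..<n] (\<lambda>j Y.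
        bind_timed (max_over n (F j Y)) (\<lambda>m. store Y (Suc t, j) m)) Y)
      ((n - 0) * (n * (c + 3) + 1)) (\<lambda>Y. row t n Y \<and> row (Suc t) n Y)"
    if "row t n Y" and F: "\<And>j k Y. j < n \<Longrightarrow> k < n \<Longrightarrow> row t n Y \<Longrightarrow>
        returns_within (F j Y k) c (\<lambda>x. x = y t k + u j k)"
    for t c Y and F :: "nat \<Rightarrow> (nat \<times> nat \<Rightarrow> real) \<Rightarrow> nat \<Rightarrow> real timed"
  proof (rule returns_within_for_each_upt[where Inv = "\<lambda>j Y. row t n Y \<and> row (Suc t) j Y"])
    fix j Y assume j: "j < n" "row t n Y \<and> row (Suc t) j Y"
    show "returns_within (bind_timed (max_over n (F j Y)) (\<lambda>m. store Y (Suc t, j) m))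
        (n * (c + 3) + 1) (\<lambda>Y. row t n Y \<and> row (Suc t) (Suc j) Y)"
      unfolding store_def using j n
      by (intro returns_within_bind[OF returns_within_max_over[where g = "\<lambda>k. y t k + u j k"]]
          returns_within_tick F)
        (auto simp: row_def y_def less_Suc_eq)
  qed (use that in \<open>auto simp: row_def\<close>)

  have loop: "returns_within (while_timed
       (\<lambda>(t, y). for_some [0..<n] (\<lambda>j. less (y (t - 1, j)) (y (t, j))))
       (\<lambda>(t, y). do {
          y \<leftarrow> for_each [0..<n] (\<lambda>j y. do {
                 m \<leftarrow> max_over n (\<lambda>k. add (y (t, k)) (U (j, k)));
                 store y (t + 1, j) m }) y;
          t' \<leftarrow> add t 1;
          t \<leftarrow> assign t';
          return (t, y) })
       (1, Y)) (length [0..<n] * 1 + (n - 1) *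
         (length [0..<n] * 1 + ((n - 0) * (n * (1 + 3) + 1) + (1 + (1 + 0))))) Inv"
    if "U_ok U" "row 0 n Y \<and> row 1 n Y" for U Y
  \<comment> \<open>The variant \<open>n - t\<close> starts at \<open>n - 1\<close>, which is the
    number of iterations paid for.\<close>
  proof (rule returns_within_while[where \<mu> = "\<lambda>s. n - fst s" and B = B and s = "(1, Y)",
        unfolded fst_conv])
    show "Inv (1, Y)" using that n by (simp add: Inv_def)
  next
    fix s assume "Inv s"
    show "returns_within ((\<lambda>(t, y). for_some [0..<n] (\<lambda>j. less (y (t - 1, j)) (y (t, j)))) s)
       (length [0..<n] * 1) (\<lambda>b. b = B s)"
      unfolding B_def case_prod_beta less_def
      by (intro returns_within_for_some returns_within_tick) auto
  next
    fix s assume "Inv s" "B s"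
    obtain t Y where s: "s = (t, Y)" by (cases s)
    with \<open>Inv s\<close> have tY: "1 \<le> t" "t \<le> n" "row (t - 1) n Y" "row t n Y"
      by (auto simp: Inv_def)
    \<comment> \<open>At \<open>t = n\<close> stationarity makes the test fail, so the body runs
      only with \<open>t < n\<close> and preserves \<open>t \<le> n\<close>.\<close>
    have "t \<noteq> n"
      using \<open>B s\<close> tY stationary by (force simp: B_def s row_def)
    then have "t < n" using tY by simp
    show "returns_within ((\<lambda>(t, y). do {
          y \<leftarrow> for_each [0..<n] (\<lambda>j y. do {
                 m \<leftarrow> max_over n (\<lambda>k. add (y (t, k)) (U (j, k)));
                 store y (t + 1, j) m }) y;
          t' \<leftarrow> add t 1;
          t \<leftarrow> assign t';
          return (t, y) }) s) ((n - 0) * (n * (1 + 3) + 1) + (1 + (1 + 0)))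
        (\<lambda>s'. Inv s' \<and> n - fst s' < n - fst s)"
      unfolding s fst_conv prod.case Suc_eq_plus1[of t, symmetric]
    proof (rule returns_within_bind[OF update])
      fix Y' assume "row t n Y' \<and> row (Suc t) n Y'"
      then show "returns_within (do { t' \<leftarrow> add t 1; t \<leftarrow> assign t'; return (t, Y') }) (1 + (1 + 0))
        (\<lambda>s'. Inv s' \<and> n - fst s' < n - t)"
        unfolding add_def assign_def using \<open>t < n\<close>
        by (intro returns_within_bind[OF returns_within_tick[where Q = "\<lambda>x. x = Suc t"]]
            returns_within_return) (auto simp: Inv_def)
    qed (use tY that in \<open>auto simp: add_def row_def U_ok_def simp del: One_nat_def intro!: returns_within_tick\<close>)
  qed

  have final: "returns_within (for_each [0..<n] (\<lambda>j p. do {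
      d \<leftarrow> sub (V' $$ (j, j)) (Y (t, j)); store p j d }) undefined) ((n - 0) * (1 + 1)) (\<lambda>_. True)"
    for Y :: "nat \<times> nat \<Rightarrow> real" and t :: nat
    unfolding sub_def store_def
    by (intro returns_within_for_each_upt[where Inv = "\<lambda>_ _. True"] TrueI
        returns_within_bind[OF returns_within_tick[where Q = "\<lambda>_. True"]] returns_within_tick) auto

  \<comment> \<open>The summands follow the execution: \<open>u\<close>, the zero row, the first row
    of maxima, the assignment of \<open>t\<close>, the loop, the prices.\<close>
  have "returns_within (PricesEFPM V')
     ((n - 0) * ((n - 0) * (1 + 1)) + ((n - 0) * 1 + ((n - 0) * (n * (0 + 3) + 1) + (1 +
       ((length [0..<n] * 1 + (n - 1) *
           (length [0..<n] * 1 + ((n - 0) * (n * (1 + 3) + 1) + (1 + (1 + 0))))) +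
         ((n - 0) * (1 + 1) + 0)))))) (\<lambda>_. True)"
    unfolding PricesEFPM_def Let_def n_def[symmetric] init_u_def[symmetric]
  proof (rule returns_within_bind[OF init_u], rule returns_within_bind[OF init_y],
      rule returns_within_bind[OF update[where t = 0, unfolded One_nat_def[symmetric]]],
      assumption, goal_cases)
    case (1 U Y j k Y')
    \<comment> \<open>Since \<open>y 0 k = 0\<close>, reading \<open>u j k\<close> already yields
      the candidate for the first row.\<close>
    then show ?case
      by (intro returns_within_return) (simp add: U_ok_def y_def)
  next
    case (2 U Y Y')
    have "returns_within (assign (1 :: nat)) 1 (\<lambda>t. t = 1)"
      unfolding assign_def by (rule returns_within_tick_eq)
    then show ?case
    proof (rule returns_within_bind, goal_cases)
      case (1 t)
      show ?case
        unfolding 1 case_prod_beta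
        by (intro returns_within_bind[OF loop[unfolded case_prod_beta]] 2
            returns_within_bind[OF final] returns_within_return TrueI)
    qed
  qed
  then show ?thesis
  proof (rule returns_within_mono)
    show "((n - 0) * ((n - 0) * (1 + 1)) + ((n - 0) * 1 + ((n - 0) * (n * (0 + 3) + 1) + (1 +
       ((length [0..<n] * 1 + (n - 1) *
           (length [0..<n] * 1 + ((n - 0) * (n * (1 + 3) + 1) + (1 + (1 + 0))))) +
         ((n - 0) * (1 + 1) + 0)))))) \<le> 19 * n ^ 3"
    proof -
      \<comment> \<open>The budget equals 4n^3 + 3n^2 + 5n - 1, which 19n^3 generously covers for
        positive \<open>n\<close>. Writing \<open>n\<close> as a successor removes the truncated
        subtraction.\<close>
      obtain m where "n = Suc m" using n by (cases n) auto
      then show ?thesis by (simp add: algebra_simps power3_eq_cube)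
    qed
  qed
qed

theorem theorem3p5:
  shows "\<exists>T :: nat \<Rightarrow> real. T \<in> O(\<lambda>n. real n ^ 3) \<and>
    (\<forall>n (V :: real mat) (X :: real mat).
       n \<ge> 1 \<longrightarrow>
       V \<in> carrier_mat n n \<longrightarrow>
       (\<forall>i<n. \<forall>j<n. V $$ (i, j) \<ge> 0) \<longrightarrow>
       max_weight_perfect_matching n V X \<longrightarrow>
       (\<exists>p c. PricesEFPM (X\<^sup>T * V) = Returns p c \<and> real c \<le> T n))"
proof (intro exI[of _ "\<lambda>n. 19 * real n ^ 3"] conjI allI impI)
  fix n and V X :: "real mat"
  assume n: "1 \<le> n" and V: "V \<in> carrier_mat n n" and X: "max_weight_perfect_matching n V X"
  have "dim_row (X\<^sup>T * V) = n"
    using X by (auto simp: max_weight_perfect_matching_def permutation_matrix_def)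
  then have "returns_within (PricesEFPM (X\<^sup>T * V)) (19 * n ^ 3) (\<lambda>_. True)"
    using PricesEFPM_returns_within[of "X\<^sup>T * V"] n max_weight_perfect_matching_diagonal[OF V X]
    by simp
  then obtain p c where "PricesEFPM (X\<^sup>T * V) = Returns p c" "c \<le> 19 * n ^ 3"
    by (auto simp: returns_within_def)
  moreover from this(2) have "real c \<le> real (19 * n ^ 3)"
    by (rule of_nat_mono)
  ultimately show "\<exists>p c. PricesEFPM (X\<^sup>T * V) = Returns p c \<and> real c \<le> 19 * real n ^ 3"
    by auto
qed simp

end
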